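(* Let $n,L\in\mathbb{N}$, $k\in\{0,\dots,n-1\}$, and let $U\in\mathbb{R}^{n\times(n-k)}$ satisfy $U^\top U=I_{n-k}$. Let $V=\operatorname{span}(U)$ be the column space of $U$. For $\ell=1,\dots,L$ let $G_\ell:\mathbb{R}^{n-k}\to\mathbb{R}^{n-k}$ be Lipschitz continuous with $G_\ell'(y)\in\mathcal{O}(n-k)$ for a.e. $y\in\mathbb{R}^{n-k}$, and define $F_\ell:\mathbb{R}^n\to\mathbb{R}^n$ by $$F_\ell(x)=U\,G_\ell(U^\top x).$$ Then each layer $F_\ell$ is subspace orthogonal on the fixed subspace $V$, i.e., for a.e. $x\in\mathbb{R}^n$ one has $\|F_\ell'(x)v\|_2=\|v\|_2$ for all $v\in V$; and $F=F_L\circ\cdots\circ F_1$ satisfies the persistent subspace orthogonality (PSO) condition over $\mathbb{R}^n$.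
   Context: $\mathcal{O}(m)$ is the set of real $m\times m$ orthogonal matrices; $F'(x)$ denotes the Jacobian of $F$ at $x$ where defined. Persistent subspace orthogonality (PSO): let $F=F_L\circ\cdots\circ F_1$ with each $F_\ell:\mathbb{R}^n\to\mathbb{R}^n$ Lipschitz continuous, and let $\Omega\subseteq\mathbb{R}^n$. For $x\in\Omega$ set $x_1=x$ and $x_{\ell+1}=F_\ell(x_\ell)$. $F$ satisfies PSO over $\Omega$ if: (1) for $\ell=1,\dots,L$ and a.e. $x\in\Omega$ there is a non-trivial subspace $V^{(\ell)}_{x_\ell}\subseteq\mathbb{R}^n$ with $\|F_\ell'(x_\ell)v\|_2=\|v\|_2$ for every $v\in V^{(\ell)}_{x_\ell}$; and (2) for a.e. $x\in\Omega$ the subspace $$W_x=V^{(1)}_{x_1}\cap\big(F_1'(x_1)\big)^{-1}V^{(2)}_{x_2}\cap\big(F_2'(x_2)F_1'(x_1)\big)^{-1}V^{(3)}_{x_3}\cap\cdots\cap\big(F_{L-1}'(x_{L-1})\cdots F_1'(x_1)\big)^{-1}V^{(L)}_{x_L}$$ is non-trivial. Here $M^{-1}V$ denotes the preimage $\{v: Mv\in V\}$, and non-trivial means different from $\{0\}$. *)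

theory Defs
  imports "HOL-Analysis.Analysis"
begin

text \<open>
  A network with layers \<open>F 1, \<dots>, F L\<close> is given by its family of layers \<open>F\<close>, since persistent
  subspace orthogonality depends on the factorisation and not only on the composed map.
  \<open>compose_layers F l\<close> is \<open>F l \<circ> \<dots> \<circ> F 1\<close>, the identity for \<open>l = 0\<close>.
\<close>

primrec compose_layers :: "(nat \<Rightarrow> 'a \<Rightarrow> 'a) \<Rightarrow> nat \<Rightarrow> 'a \<Rightarrow> 'a" where
  "compose_layers F 0 = id"
| "compose_layers F (Suc l) = F (Suc l) \<circ> compose_layers F l"

text \<open>
  The point \<open>x\<^sub>l\<close> at which layer \<open>l \<ge> 1\<close> is evaluated:
  \<open>x\<^sub>1 = x\<close> and \<open>x\<^sub>l\<^sub>+\<^sub>1 = F l x\<^sub>l\<close>.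
\<close>

definition layer_input :: "(nat \<Rightarrow> 'a \<Rightarrow> 'a) \<Rightarrow> nat \<Rightarrow> 'a \<Rightarrow> 'a" where
  "layer_input F l x = compose_layers F (l - 1) x"

text \<open>
  \<open>jacobian_product F l x\<close> is the matrix product \<open>F\<^sub>l'(x\<^sub>l) \<cdots> F\<^sub>1'(x\<^sub>1)\<close> of layer Jacobians, not the
  Jacobian of the composed map. The factors are meaningful only where the layers are
  differentiable.
\<close>

primrec jacobian_product ::
  "(nat \<Rightarrow> real^'n \<Rightarrow> real^'n) \<Rightarrow> nat \<Rightarrow> real^'n \<Rightarrow> real^'n^'n" where
  "jacobian_product F 0 x = mat 1"
| "jacobian_product F (Suc l) x =
     jacobian (F (Suc l)) (at (layer_input F (Suc l) x)) ** jacobian_product F l x"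

text \<open>
  Since \<^const>\<open>jacobian\<close> is total, existence of \<open>f'(x)\<close> has to be demanded separately.
\<close>

definition subspace_orthogonal_at ::
  "(real^'n \<Rightarrow> real^'n) \<Rightarrow> real^'n \<Rightarrow> (real^'n) set \<Rightarrow> bool" where
  "subspace_orthogonal_at f x V \<longleftrightarrow>
     f differentiable (at x) \<and> (\<forall>v\<in>V. norm (jacobian f (at x) *v v) = norm v)"

definition persistent_subspace ::
  "(nat \<Rightarrow> real^'n \<Rightarrow> real^'n) \<Rightarrow> nat \<Rightarrow> (nat \<Rightarrow> real^'n \<Rightarrow> (real^'n) set)
    \<Rightarrow> real^'n \<Rightarrow> (real^'n) set" where
  "persistent_subspace F L V x =
     (\<Inter>l\<in>{1..L}. {v. jacobian_product F (l - 1) x *v v \<in> V l (layer_input F l x)})"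

text \<open>
  \<open>V l y\<close> is the subspace attached to layer \<open>l\<close> at the point \<open>y = x\<^sub>l\<close>. As \<open>\<Omega>\<close> need not be measurable,
  ``for almost every \<open>x \<in> \<Omega>\<close>'' is read as: the exceptional points of \<open>\<Omega>\<close> form a Lebesgue null set.
\<close>

definition PSO ::
  "(nat \<Rightarrow> real^'n \<Rightarrow> real^'n) \<Rightarrow> nat \<Rightarrow> (real^'n) set \<Rightarrow> bool" where
  "PSO F L \<Omega> \<longleftrightarrow>
     (\<forall>l\<in>{1..L}. \<exists>C. C-lipschitz_on UNIV (F l)) \<and>
     (\<exists>V :: nat \<Rightarrow> real^'n \<Rightarrow> (real^'n) set.
        (\<forall>l\<in>{1..L}. AE x in lebesgue. x \<in> \<Omega> \<longrightarrow>
            subspace (V l (layer_input F l x)) \<and> V l (layer_input F l x) \<noteq> {0} \<and>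
            subspace_orthogonal_at (F l) (layer_input F l x) (V l (layer_input F l x))) \<and>
        (AE x in lebesgue. x \<in> \<Omega> \<longrightarrow> persistent_subspace F L V x \<noteq> {0}))"

end

theory Submission
  imports Defs
begin

text \<open>
  In the coordinates \<open>y = U\<^sup>T x\<close> the network is \<open>G\<^sub>L \<circ> \<dots> \<circ> G\<^sub>1\<close>, and
  \<open>F\<^sub>l'(x) = U G\<^sub>l'(U\<^sup>T x) U\<^sup>T\<close> maps \<open>V\<close> isometrically to itself, so that \<open>V \<subseteq> W\<^sub>x\<close>.
  The layer inputs with \<open>l \<ge> 2\<close> lie in \<open>V\<close>, a null set if \<open>k > 0\<close>, so almost everywhere statements about a
  layer must be pulled back to the input \<open>x\<close>. This works because preimages of null sets are null,
  both under \<open>U\<^sup>T\<close> (surjective linear) and under each \<open>G\<^sub>l\<close>: its derivative is almost everywhere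
  injective, so up to a null set the domain is a countable union of pieces on which \<open>G\<^sub>l\<close> has a
  Lipschitz inverse.
\<close>

section \<open>Preimages of null sets\<close>

lemma AE_lebesgue_iff_negligible:
  "(AE x in lebesgue. P x) \<longleftrightarrow> negligible {x. \<not> P x}"
proof
  assume "AE x in lebesgue. P x"
  then obtain N where "{x. \<not> P x} \<subseteq> N" "N \<in> null_sets lebesgue"
    unfolding eventually_ae_filter by auto
  then show "negligible {x. \<not> P x}"
    by (meson negligible_iff_null_sets negligible_subset)
next
  assume "negligible {x. \<not> P x}"
  then show "AE x in lebesgue. P x"
    unfolding eventually_ae_filter by (auto simp: negligible_iff_null_sets)
qed

lemma negligible_preimage_expanding:
  fixes f :: "'a::euclidean_space \<Rightarrow> 'a"
  assumes "c > 0"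
    and exp: "\<And>x y. x \<in> S \<Longrightarrow> y \<in> S \<Longrightarrow> c * norm (y - x) \<le> norm (f y - f x)"
    and "negligible N"
  shows "negligible (S \<inter> f -` N)"
proof -
  have inj: "inj_on f S"
  proof (rule inj_onI)
    fix x y assume "x \<in> S" "y \<in> S" "f x = f y"
    with exp[of x y] \<open>c > 0\<close> show "x = y"
      by (simp add: mult_le_0_iff)
  qed
  define g where "g = inv_into S f"
  have g: "g (f x) = x" if "x \<in> S" for x
    using inj that by (simp add: g_def)
  have "negligible (g ` (N \<inter> f ` S))"
  proof (rule negligible_locally_Lipschitz_image)
    show "negligible (N \<inter> f ` S)"
      using assms by (simp add: negligible_Int)
    fix u assume u: "u \<in> N \<inter> f ` S"
    have "norm (g v - g u) \<le> inverse c * norm (v - u)" if "v \<in> N \<inter> f ` S" for v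
      using u that exp \<open>c > 0\<close> by (auto simp: g field_simps)
    then show "\<exists>T B. open T \<and> u \<in> T \<and> (\<forall>v \<in> (N \<inter> f ` S) \<inter> T. norm (g v - g u) \<le> B * norm (v - u))"
      by (intro exI[of _ UNIV] exI[of _ "inverse c"]) auto
  qed simp
  moreover have "S \<inter> f -` N \<subseteq> g ` (N \<inter> f ` S)"
    using g by force
  ultimately show ?thesis
    by (rule negligible_subset)
qed

text \<open>An injective linear \<open>f'\<close> is bounded below by some \<open>B > 0\<close>, and
  near \<open>x\<close> the linearisation error uses up at most half of \<open>B\<close>. One index
  \<open>j\<close> controls both the radius and the expansion constant, so that countably many cases
  cover all points.\<close>

lemma has_derivative_inj_locally_expanding:
  fixes f :: "'a::euclidean_space \<Rightarrow> 'b::euclidean_space"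
  assumes "(f has_derivative f') (at x)" and "inj f'"
  obtains j :: nat where
    "\<forall>y. norm (y - x) < inverse (Suc j) \<longrightarrow> inverse (Suc j) * norm (y - x) \<le> norm (f y - f x)"
proof -
  have "linear f'"
    using assms(1) by (rule has_derivative_linear)
  then obtain B where B: "B > 0" "\<And>v. B * norm v \<le> norm (f' v)"
    using linear_inj_bounded_below_pos assms(2) by blast
  obtain d where d: "d > 0"
    "\<And>y. norm (y - x) < d \<Longrightarrow> norm (f y - f x - f' (y - x)) \<le> B / 2 * norm (y - x)"
    using assms(1) B(1) unfolding has_derivative_at_alt by (meson half_gt_zero)
  obtain j where j: "inverse (real (Suc j)) < min d (B / 2)"
    using reals_Archimedean[of "min d (B / 2)"] B(1) d(1) by auto
  have "inverse (Suc j) * norm (y - x) \<le> norm (f y - f x)"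
    if "norm (y - x) < inverse (Suc j)" for y
  proof -
    have "inverse (Suc j) * norm (y - x) \<le> B / 2 * norm (y - x)"
      using j by (intro mult_right_mono) auto
    also have "\<dots> = B * norm (y - x) - B / 2 * norm (y - x)"
      by simp
    also have "\<dots> \<le> norm (f' (y - x)) - norm (f y - f x - f' (y - x))"
      using that j B(2)[of "y - x"] d(2)[of y] by linarith
    also have "\<dots> \<le> norm (f y - f x)"
      using norm_triangle_ineq2[of "f' (y - x)" "f' (y - x) - (f y - f x)"]
      by (simp add: norm_minus_commute)
    finally show ?thesis .
  qed
  then show thesis
    using that by blast
qed

text \<open>The points of \<open>S\<close> are sorted into countably many sets \<open>E j\<close> by
  the scale at which \<open>f\<close> expands around them; each \<open>E j\<close> is treated
  locally.\<close>

lemma negligible_preimage_inj_derivative: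
  fixes f :: "'a::euclidean_space \<Rightarrow> 'a"
  assumes deriv: "\<And>x. x \<in> S \<Longrightarrow> \<exists>f'. (f has_derivative f') (at x) \<and> inj f'"
    and N: "negligible N"
  shows "negligible (S \<inter> f -` N)"
proof -
  define E where "E j = {x \<in> S. \<forall>y. norm (y - x) < inverse (Suc j) \<longrightarrow>
    inverse (Suc j) * norm (y - x) \<le> norm (f y - f x)}" for j :: nat
  have "negligible (E j \<inter> f -` N)" for j
  proof (rule locally_negligible_alt[THEN iffD2, rule_format])
    fix x assume x: "x \<in> E j \<inter> f -` N"
    define r where "r = inverse (real (Suc j))"
    have "r > 0"
      by (simp add: r_def)
    \<comment> \<open>Half the radius: any two points of the ball are closer than \<open>r\<close>,
      so the expansion around one of them applies to the other.\<close>
    let ?B = "ball x (r / 2)"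
    have "negligible ((E j \<inter> ?B) \<inter> f -` N)"
    proof (rule negligible_preimage_expanding[OF \<open>r > 0\<close> _ N])
      fix y z assume yz: "y \<in> E j \<inter> ?B" "z \<in> E j \<inter> ?B"
      then have "dist z y < r"
        using dist_triangle_half_r[of x z r y] by auto
      with yz show "r * norm (z - y) \<le> norm (f z - f y)"
        by (simp add: E_def r_def dist_norm)
    qed
    moreover have "(E j \<inter> ?B) \<inter> f -` N = (E j \<inter> f -` N) \<inter> ?B"
      by blast
    moreover have "openin (top_of_set (E j \<inter> f -` N)) ((E j \<inter> f -` N) \<inter> ?B)"
      by (simp add: openin_open_Int)
    ultimately show "\<exists>U. openin (top_of_set (E j \<inter> f -` N)) U \<and> x \<in> U \<and> negligible U"
      using x \<open>r > 0\<close> by (intro exI[of _ "(E j \<inter> f -` N) \<inter> ?B"]) auto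
  qed
  then have "negligible (\<Union>j. E j \<inter> f -` N)"
    by (intro negligible_countable_Union) auto
  moreover have "S \<inter> f -` N \<subseteq> (\<Union>j. E j \<inter> f -` N)"
  proof
    fix x assume x: "x \<in> S \<inter> f -` N"
    then obtain f' where "(f has_derivative f') (at x)" "inj f'"
      using deriv by auto
    then obtain j :: nat where
      "\<forall>y. norm (y - x) < inverse (Suc j) \<longrightarrow> inverse (Suc j) * norm (y - x) \<le> norm (f y - f x)"
      by (rule has_derivative_inj_locally_expanding)
    with x show "x \<in> (\<Union>j. E j \<inter> f -` N)"
      by (auto simp: E_def)
  qed
  ultimately show ?thesis
    by (rule negligible_subset)
qed

lemma AE_lebesgue_compose_inj_derivative:
  fixes f :: "'a::euclidean_space \<Rightarrow> 'a"
  assumes deriv: "AE x in lebesgue. \<exists>f'. (f has_derivative f') (at x) \<and> inj f'"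
    and "AE y in lebesgue. P y"
  shows "AE x in lebesgue. P (f x)"
proof -
  let ?S = "{x. \<exists>f'. (f has_derivative f') (at x) \<and> inj f'}"
  have "negligible (?S \<inter> f -` {y. \<not> P y})"
    using assms(2) by (intro negligible_preimage_inj_derivative)
      (auto simp: AE_lebesgue_iff_negligible)
  then have "negligible ((?S \<inter> f -` {y. \<not> P y}) \<union> {x. \<not> (\<exists>f'. (f has_derivative f') (at x) \<and> inj f')})"
    using deriv by (intro negligible_Un) (auto simp: AE_lebesgue_iff_negligible)
  then show ?thesis
    unfolding AE_lebesgue_iff_negligible by (rule negligible_subset) auto
qed

text \<open>
  Every translate of \<open>N\<close> is null, so by Fubini \<open>{x. f x + y \<in> N}\<close> is null for almost every \<open>y\<close>. Since
  \<open>f\<close> is surjective, this set is a translate of the preimage of \<open>N\<close>.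
\<close>

lemma AE_lebesgue_compose_linear_surj:
  fixes f :: "'a::euclidean_space \<Rightarrow> 'b::euclidean_space"
  assumes "linear f" "surj f" and ae: "AE y in lebesgue. P y"
  shows "AE x in lebesgue. P (f x)"
proof -
  have "{y. \<not> P y} \<in> null_sets lebesgue"
    using ae by (simp add: AE_lebesgue_iff_negligible negligible_iff_null_sets)
  \<comment> \<open>The exceptional set is enlarged to a Borel null set, which makes the set in the
    Fubini argument measurable.\<close>
  then obtain N where N: "N \<in> null_sets lborel" "{y. \<not> P y} \<subseteq> N"
    unfolding null_sets_completion_iff2 by blast
  have [measurable]: "N \<in> sets borel" and [measurable]: "f \<in> borel_measurable borel"
    using N(1) assms(1)
    by (auto intro!: borel_measurable_continuous_onI linear_continuous_on
        simp: linear_conv_bounded_linear)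
  have "AE x in lborel. AE y in lborel. f x + y \<notin> N"
  proof (rule AE_I2)
    fix x
    have "{y. y - (- f x) \<in> N} \<in> null_sets lborel"
      using N(1) by (rule null_sets_translation)
    then show "AE y in lborel. f x + y \<notin> N"
      by (intro AE_I') (auto simp: add.commute)
  qed
  moreover have "{z \<in> space (lborel \<Otimes>\<^sub>M lborel). f (fst z) + snd z \<notin> N} \<in> sets (lborel \<Otimes>\<^sub>M lborel)"
    by measurable
  ultimately have "AE y in lborel. AE x in lborel. f x + y \<notin> N"
    by (simp only: lborel_pair.AE_commute)
  then have "\<exists>y. AE x in lborel. f x + y \<notin> N"
    by (rule eventually_happens'[rotated]) (simp add: ae_filter_eq_bot_iff)
  then obtain y where y: "AE x in lborel. f x + y \<notin> N"
    by blast
  obtain a where a: "y = f a"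
    using \<open>surj f\<close> by blast
  have "{x \<in> space lborel. f x + y \<in> N} \<in> sets lborel"
    by measurable
  then have "{x. f x + y \<in> N} \<in> null_sets lborel"
    using y by (simp add: AE_iff_null_sets)
  \<comment> \<open>Since \<open>y = f a\<close>, linearity gives
    \<open>f (x - a) + y = f x\<close>.\<close>
  then have "{x. x - a \<in> {x. f x + y \<in> N}} \<in> null_sets lborel"
    by (rule null_sets_translation)
  then have "AE x in lborel. P (f x)"
    using N(2) by (intro AE_I') (auto simp: a linear_diff[OF \<open>linear f\<close>])
  then show ?thesis
    by (rule AE_completion)
qed

text \<open>The outermost layer is peeled off first: it pulls \<open>P\<close> back to a new
  property, to which the induction hypothesis applies. Hence \<open>P\<close> is kept
  arbitrary.\<close>

lemma AE_lebesgue_compose_layers: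
  fixes G :: "nat \<Rightarrow> 'a::euclidean_space \<Rightarrow> 'a"
  assumes "\<And>l. l \<in> {1..L} \<Longrightarrow> AE x in lebesgue. \<exists>G'. (G l has_derivative G') (at x) \<and> inj G'"
    and "l \<le> L" and "AE y in lebesgue. P y"
  shows "AE y in lebesgue. P (compose_layers G l y)"
  using assms(2,3)
proof (induction l arbitrary: P)
  case (Suc l)
  have "AE y in lebesgue. P (G (Suc l) y)"
    by (rule AE_lebesgue_compose_inj_derivative[OF assms(1) Suc.prems(2)])
      (use Suc.prems(1) in simp)
  then have "AE y in lebesgue. P (G (Suc l) (compose_layers G l y))"
    using Suc.prems(1) by (intro Suc.IH) auto
  then show ?case
    by simp
qed simp

section \<open>Orthonormal columns and Jacobians of conjugated maps\<close>

lemma span_columns_eq_range: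
  fixes A :: "real^'m^'n"
  shows "span (columns A) = range ((*v) A)"
proof
  have "columns A \<subseteq> range ((*v) A)"
    by (auto simp: columns_def matrix_vector_mult_basis[symmetric])
  then show "span (columns A) \<subseteq> range ((*v) A)"
    by (intro span_minimal linear_subspace_image) auto
qed (auto intro: matrix_vector_mult_in_columnspace)

lemma norm_matrix_vector_mult_isometry:
  fixes A :: "real^'m^'n"
  assumes "transpose A ** A = mat 1"
  shows "norm (A *v v) = norm v"
proof -
  have "(A *v v) \<bullet> (A *v v) = ((A *v v) v* A) \<bullet> v"
    by (simp only: dot_lmul_matrix)
  also have "\<dots> = (transpose A ** A *v v) \<bullet> v"
    by (simp only: transpose_matrix_vector[symmetric] matrix_vector_mul_assoc)
  finally have "(A *v v) \<bullet> (A *v v) = (transpose A ** A *v v) \<bullet> v" .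
  then show ?thesis
    by (simp add: assms norm_eq)
qed

lemma jacobian_eqI:
  fixes f :: "real^'m \<Rightarrow> real^'n"
  assumes "(f has_derivative (*v) A) (at x)"
  shows "jacobian f (at x) = A"
  using frechet_derivative_at[OF assms] by (metis jacobian_def matrix_of_matrix_vector_mul)

lemma jacobian_conjugate:
  fixes U :: "real^'m^'n" and g :: "real^'m \<Rightarrow> real^'m"
  assumes "g differentiable (at (transpose U *v x))"
    and f: "f = (\<lambda>x. U *v g (transpose U *v x))"
  shows "f differentiable (at x)"
    and "jacobian f (at x) = U ** jacobian g (at (transpose U *v x)) ** transpose U"
proof -
  let ?J = "jacobian g (at (transpose U *v x))"
  have g: "(g has_derivative (*v) ?J) (at (transpose U *v x))"
    using assms(1) by (simp add: jacobian_works)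
  have lin: "((*v) A has_derivative (*v) A) (at y)" for A :: "real^'i^'j" and y
    by (intro bounded_linear_imp_has_derivative) simp
  have "((\<lambda>x. g (transpose U *v x)) has_derivative (\<lambda>h. ?J *v (transpose U *v h))) (at x)"
    using has_derivative_compose[OF lin g] .
  from has_derivative_compose[OF this lin[of U]]
  have *: "(f has_derivative (*v) (U ** ?J ** transpose U)) (at x)"
    by (simp add: f matrix_vector_mul_assoc matrix_mul_assoc del: transpose_matrix_vector)
  then show "f differentiable (at x)"
    by (rule differentiableI)
  show "jacobian f (at x) = U ** ?J ** transpose U"
    using * by (rule jacobian_eqI)
qed

text \<open>On the column space \<open>transpose U\<close> undoes \<open>U\<close>, so the Jacobian
  of \<open>f\<close> sends \<open>U *v w\<close> to \<open>U *v (J *v w)\<close> with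
  \<open>J\<close> the Jacobian of \<open>g\<close>; both \<open>J\<close> and \<open>U\<close>
  preserve norms.\<close>

lemma subspace_orthogonal_at_conjugate:
  fixes U :: "real^'m^'n" and g :: "real^'m \<Rightarrow> real^'m"
  assumes U: "transpose U ** U = mat 1"
    and g: "g differentiable (at (transpose U *v x))"
    and orth: "orthogonal_matrix (jacobian g (at (transpose U *v x)))"
    and f: "f = (\<lambda>x. U *v g (transpose U *v x))"
  shows "subspace_orthogonal_at f x (span (columns U))"
proof -
  let ?J = "jacobian g (at (transpose U *v x))"
  have "norm (U ** ?J ** transpose U *v (U *v w)) = norm (U *v w)" for w
  proof -
    have "U ** ?J ** transpose U *v (U *v w) = U *v (?J *v w)"
      by (metis U matrix_mul_rid matrix_vector_mul_assoc)
    also have "norm \<dots> = norm w"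
      using orth U by (simp add: norm_matrix_vector_mult_isometry orthogonal_matrix)
    finally show ?thesis
      by (simp add: norm_matrix_vector_mult_isometry U)
  qed
  then show ?thesis
    using jacobian_conjugate[OF g f]
    by (auto simp: subspace_orthogonal_at_def span_columns_eq_range)
qed

text \<open>Between consecutive layers \<open>transpose U ** U\<close> cancels.\<close>

lemma compose_layers_conjugate:
  fixes U :: "real^'m^'n"
  assumes U: "transpose U ** U = mat 1"
    and F: "\<And>l x. l \<in> {1..L} \<Longrightarrow> F l x = U *v G l (transpose U *v x)"
    and "l \<le> L"
  shows "transpose U *v compose_layers F l x = compose_layers G l (transpose U *v x)"
  using \<open>l \<le> L\<close>
proof (induction l)
  case (Suc l)
  then show ?case
    by (simp add: F matrix_vector_mul_assoc U del: transpose_matrix_vector)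
qed simp

text \<open>With \<open>V\<close> the column space of \<open>U\<close>, this puts \<open>V\<close>
  inside each of the preimages whose intersection is the persistent subspace.\<close>

lemma jacobian_product_in_invariant:
  assumes "v \<in> V"
    and "\<And>i w. i \<in> {1..l} \<Longrightarrow> w \<in> V \<Longrightarrow> jacobian (F i) (at (layer_input F i x)) *v w \<in> V"
  shows "jacobian_product F l x *v v \<in> V"
  using assms(2)
proof (induction l)
  case 0
  then show ?case
    using \<open>v \<in> V\<close> by simp
next
  case (Suc l)
  then show ?case
    by (simp flip: matrix_vector_mul_assoc)
qed

section \<open>Orthogonality of the layers and persistence of the column space\<close>

theorem mainTheorem2:
  fixes L k :: nat
    and U :: "real^'m^'n"
    and G :: "nat \<Rightarrow> real^'m \<Rightarrow> real^'m"
    and F :: "nat \<Rightarrow> real^'n \<Rightarrow> real^'n"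
  assumes "k < CARD('n)"
    and "CARD('m) = CARD('n) - k"
    and "transpose U ** U = mat 1"
    and "\<And>l. l \<in> {1..L} \<Longrightarrow> \<exists>C. C-lipschitz_on UNIV (G l)"
    and "\<And>l. l \<in> {1..L} \<Longrightarrow>
           AE y in lebesgue. G l differentiable (at y) \<and> orthogonal_matrix (jacobian (G l) (at y))"
    and "\<And>l x. l \<in> {1..L} \<Longrightarrow> F l x = U *v G l (transpose U *v x)"
  shows "(\<forall>l\<in>{1..L}. AE x in lebesgue. subspace_orthogonal_at (F l) x (span (columns U)))
         \<and> PSO F L UNIV"
proof -
  let ?V = "span (columns U)"
  have G_good: "AE y in lebesgue. G l differentiable (at y) \<and> orthogonal_matrix (jacobian (G l) (at y))"
    if "l \<in> {1..L}" for l
    using assms(5) that .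
  have F: "F l = (\<lambda>x. U *v G l (transpose U *v x))" if "l \<in> {1..L}" for l
    using assms(6) that by blast
  have V: "subspace ?V" "?V \<noteq> {0}"
  proof -
    \<comment> \<open>Any unit vector serves as witness, because \<open>U\<close> preserves
      norms.\<close>
    have "U *v axis undefined 1 \<noteq> 0"
      using norm_matrix_vector_mult_isometry[OF assms(3), of "axis undefined 1"] by auto
    moreover have "U *v axis undefined 1 \<in> ?V"
      by (rule matrix_vector_mult_in_columnspace)
    ultimately show "?V \<noteq> {0}"
      by auto
  qed simp
  have G_inj: "AE y in lebesgue. \<exists>G'. (G l has_derivative G') (at y) \<and> inj G'" if "l \<in> {1..L}" for l
    using G_good[OF that]
  proof eventually_elim
    case (elim y)
    then have "inj ((*v) (jacobian (G l) (at y)))"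
      by (intro inj_matrix_vector_mult) (auto simp: invertible_def orthogonal_matrix_def)
    with elim show ?case
      by (auto simp: jacobian_works)
  qed
  \<comment> \<open>\<open>U\<close> is a right inverse of \<open>transpose U\<close>.\<close>
  have surj: "surj ((*v) (transpose U))"
    by (metis assms(3) matrix_right_invertible_surjective)
  have input_good: "AE x in lebesgue. G l differentiable (at (transpose U *v layer_input F l x)) \<and>
      orthogonal_matrix (jacobian (G l) (at (transpose U *v layer_input F l x)))"
    if "l \<in> {1..L}" for l
  proof -
    have le: "l - 1 \<le> L"
      using that by auto
    have "AE x in lebesgue. G l differentiable (at (compose_layers G (l - 1) (transpose U *v x))) \<and>
        orthogonal_matrix (jacobian (G l) (at (compose_layers G (l - 1) (transpose U *v x))))"
      \<comment> \<open>The property of \<open>G l\<close> is pulled back through the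
        \<open>l - 1\<close> preceding layers in the small space, and only then along
        \<open>transpose U\<close> to the input \<open>x\<close>.\<close>
      by (rule AE_lebesgue_compose_linear_surj[OF matrix_vector_mul_linear surj
            AE_lebesgue_compose_layers[OF G_inj le G_good[OF that]]])
    then show ?thesis
      by (simp only: layer_input_def compose_layers_conjugate[where G = G, OF assms(3,6) le])
  qed
  have layers: "\<forall>l\<in>{1..L}. AE x in lebesgue. subspace_orthogonal_at (F l) x ?V"
  proof
    fix l assume l: "l \<in> {1..L}"
    have "AE x in lebesgue. G l differentiable (at (transpose U *v x)) \<and>
        orthogonal_matrix (jacobian (G l) (at (transpose U *v x)))"
      by (rule AE_lebesgue_compose_linear_surj[OF matrix_vector_mul_linear surj G_good[OF l]])
    then show "AE x in lebesgue. subspace_orthogonal_at (F l) x ?V"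
      by eventually_elim (elim conjE, rule subspace_orthogonal_at_conjugate[OF assms(3) _ _ F[OF l]])
  qed
  have lipschitz: "\<forall>l\<in>{1..L}. \<exists>C. C-lipschitz_on UNIV (F l)"
  proof
    fix l assume l: "l \<in> {1..L}"
    obtain C where C: "C-lipschitz_on UNIV (G l)"
      using assms(4) l by blast
    have lin: "\<exists>B. B-lipschitz_on UNIV ((*v) A)" for A :: "real^'i^'j"
      by (rule bounded_linear.lipschitz_boundE[OF matrix_vector_mul_bounded_linear[of A]]) blast
    obtain B where B: "B-lipschitz_on UNIV ((*v) (transpose U))"
      using lin by blast
    obtain D where D: "D-lipschitz_on UNIV ((*v) U)"
      using lin by blast
    have "(D * (C * B))-lipschitz_on UNIV (\<lambda>x. U *v G l (transpose U *v x))"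
      by (intro lipschitz_on_compose2 B lipschitz_on_subset[OF C] lipschitz_on_subset[OF D] subset_UNIV)
    then show "\<exists>C. C-lipschitz_on UNIV (F l)"
      unfolding F[OF l] ..
  qed
  have orth: "\<forall>l\<in>{1..L}. AE x in lebesgue. subspace_orthogonal_at (F l) (layer_input F l x) ?V"
  proof
    fix l assume l: "l \<in> {1..L}"
    show "AE x in lebesgue. subspace_orthogonal_at (F l) (layer_input F l x) ?V"
      using input_good[OF l]
      by eventually_elim (elim conjE, rule subspace_orthogonal_at_conjugate[OF assms(3) _ _ F[OF l]])
  qed
  \<comment> \<open>The persistent subspace at \<open>x\<close> involves all layers at once; the
    finitely many exceptional null sets are united.\<close>
  have "AE x in lebesgue. \<forall>l\<in>{1..L}. G l differentiable (at (transpose U *v layer_input F l x))"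
    using input_good by (intro AE_finite_allI) auto
  then have persistent: "AE x in lebesgue. persistent_subspace F L (\<lambda>_ _. ?V) x \<noteq> {0}"
  proof eventually_elim
    case (elim x)
    have "jacobian (F i) (at (layer_input F i x)) *v w \<in> ?V" if "i \<in> {1..L}" for i w
      \<comment> \<open>The Jacobian has \<open>U\<close> as its leftmost factor, so its values lie
        in the column space for every \<open>w\<close>.\<close>
      unfolding jacobian_conjugate(2)[OF bspec[OF elim that] F[OF that]]
        matrix_vector_mul_assoc[symmetric]
      by (rule matrix_vector_mult_in_columnspace)
    then have "jacobian_product F (l - 1) x *v v \<in> ?V" if "v \<in> ?V" "l \<in> {1..L}" for v l
      using that by (intro jacobian_product_in_invariant) auto
    then have "?V \<subseteq> persistent_subspace F L (\<lambda>_ _. ?V) x"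
      by (auto simp: persistent_subspace_def)
    with V(2) span_0 show ?case
      by blast
  qed
  have "PSO F L UNIV"
    unfolding PSO_def using lipschitz orth V persistent
    \<comment> \<open>The same subspace is attached to every layer and every point.\<close>
    by (intro conjI exI[of _ "\<lambda>_ _. ?V"]) simp_all
  with layers show ?thesis
    by blast
qed

end
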